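(* Let $R$ be a ring and suppose $K$ is the unit of an additive closed symmetric monoidal structure on the category of left $R$-modules. Then $\mathrm{End}_R(K)$ is (isomorphic to) a subring of the center $Z(R)$ of $R$.
   Context: Rings are associative and unital, not necessarily commutative. A closed symmetric monoidal structure on left $R$-modules is additive if the monoidal product is an additive functor in each variable. *)

theory Defs
  imports "HOL-Algebra.Module" "HOL-Algebra.QuotRing" "HOL-Algebra.Subrings"
begin

section \<open>Categories\<close>

record ('o, 'a) cat =
  Obj :: "'o set"
  Hom :: "'o \<Rightarrow> 'o \<Rightarrow> 'a set"
  Ident :: "'o \<Rightarrow> 'a"
  Comp :: "'a \<Rightarrow> 'a \<Rightarrow> 'a"  (infixl \<open>\<cdot>\<index>\<close> 65)

locale category =
  fixes C (structure)
  assumes hom_disjoint: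
      "\<lbrakk>X \<in> Obj C; Y \<in> Obj C; X' \<in> Obj C; Y' \<in> Obj C; f \<in> Hom C X Y; f \<in> Hom C X' Y'\<rbrakk>
       \<Longrightarrow> X = X' \<and> Y = Y'"
    and ident_hom: "X \<in> Obj C \<Longrightarrow> Ident C X \<in> Hom C X X"
    and comp_hom:
      "\<lbrakk>X \<in> Obj C; Y \<in> Obj C; Z \<in> Obj C; f \<in> Hom C X Y; g \<in> Hom C Y Z\<rbrakk>
       \<Longrightarrow> g \<cdot> f \<in> Hom C X Z"
    and comp_ident_right:
      "\<lbrakk>X \<in> Obj C; Y \<in> Obj C; f \<in> Hom C X Y\<rbrakk> \<Longrightarrow> f \<cdot> Ident C X = f"
    and comp_ident_left:
      "\<lbrakk>X \<in> Obj C; Y \<in> Obj C; f \<in> Hom C X Y\<rbrakk> \<Longrightarrow> Ident C Y \<cdot> f = f"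
    and comp_assoc:
      "\<lbrakk>W \<in> Obj C; X \<in> Obj C; Y \<in> Obj C; Z \<in> Obj C;
        f \<in> Hom C W X; g \<in> Hom C X Y; h \<in> Hom C Y Z\<rbrakk>
       \<Longrightarrow> (h \<cdot> g) \<cdot> f = h \<cdot> (g \<cdot> f)"

definition Isos :: "('o, 'a, 'z) cat_scheme \<Rightarrow> 'o \<Rightarrow> 'o \<Rightarrow> 'a set" where
  "Isos C X Y = {f \<in> Hom C X Y. \<exists>g \<in> Hom C Y X.
      Comp C g f = Ident C X \<and> Comp C f g = Ident C Y}"


section \<open>Closed symmetric monoidal structures\<close>

text \<open>The axioms are those of Mac Lane, with the associator directed
  \<open>(X \<otimes> Y) \<otimes> Z \<rightarrow> X \<otimes> (Y \<otimes> Z)\<close> and the unitors \<open>K \<otimes> X \<rightarrow> X\<close> and \<open>X \<otimes> K \<rightarrow> X\<close>.\<close>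

record ('o, 'a) monoidal_structure =
  TObj :: "'o \<Rightarrow> 'o \<Rightarrow> 'o"  (infixl \<open>\<boxdot>\<index>\<close> 75)
  TArr :: "'a \<Rightarrow> 'a \<Rightarrow> 'a"  (infixl \<open>\<boxtimes>\<index>\<close> 75)
  Unit :: 'o
  Assoc :: "'o \<Rightarrow> 'o \<Rightarrow> 'o \<Rightarrow> 'a"
  LUnit :: "'o \<Rightarrow> 'a"
  RUnit :: "'o \<Rightarrow> 'a"

record ('o, 'a) symmetric_monoidal_structure = "('o, 'a) monoidal_structure" +
  Braid :: "'o \<Rightarrow> 'o \<Rightarrow> 'a"

text \<open>\<open>IObj T Y Z\<close> is the internal hom \<open>[Y, Z]\<close>, \<open>IArr T Y h\<close> is \<open>[Y, h]\<close>, and \<open>Curry T X Y Z\<close> is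
  the adjunction bijection \<open>Hom (X \<otimes> Y) Z \<rightarrow> Hom X [Y, Z]\<close>.\<close>

record ('o, 'a) closed_symmetric_monoidal_structure =
    "('o, 'a) symmetric_monoidal_structure" +
  IObj :: "'o \<Rightarrow> 'o \<Rightarrow> 'o"
  IArr :: "'o \<Rightarrow> 'a \<Rightarrow> 'a"
  Curry :: "'o \<Rightarrow> 'o \<Rightarrow> 'o \<Rightarrow> 'a \<Rightarrow> 'a"

locale monoidal_category = category C for C (structure) +
  fixes T (structure)
  assumes tensor_obj: "\<lbrakk>X \<in> Obj C; Y \<in> Obj C\<rbrakk> \<Longrightarrow> X \<boxdot>\<^bsub>T\<^esub> Y \<in> Obj C"
    and tensor_arr:
      "\<lbrakk>X \<in> Obj C; X' \<in> Obj C; Y \<in> Obj C; Y' \<in> Obj C; f \<in> Hom C X X'; g \<in> Hom C Y Y'\<rbrakk>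
       \<Longrightarrow> f \<boxtimes>\<^bsub>T\<^esub> g \<in> Hom C (X \<boxdot>\<^bsub>T\<^esub> Y) (X' \<boxdot>\<^bsub>T\<^esub> Y')"
    and tensor_ident:
      "\<lbrakk>X \<in> Obj C; Y \<in> Obj C\<rbrakk>
       \<Longrightarrow> Ident C X \<boxtimes>\<^bsub>T\<^esub> Ident C Y = Ident C (X \<boxdot>\<^bsub>T\<^esub> Y)"
    and tensor_comp:
      "\<lbrakk>X \<in> Obj C; X' \<in> Obj C; X'' \<in> Obj C; Y \<in> Obj C; Y' \<in> Obj C; Y'' \<in> Obj C;
        f \<in> Hom C X X'; f' \<in> Hom C X' X''; g \<in> Hom C Y Y'; g' \<in> Hom C Y' Y''\<rbrakk>
       \<Longrightarrow> (f' \<cdot> f) \<boxtimes>\<^bsub>T\<^esub> (g' \<cdot> g) = (f' \<boxtimes>\<^bsub>T\<^esub> g') \<cdot> (f \<boxtimes>\<^bsub>T\<^esub> g)"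
    and unit_obj: "Unit T \<in> Obj C"
    and assoc_iso:
      "\<lbrakk>X \<in> Obj C; Y \<in> Obj C; Z \<in> Obj C\<rbrakk>
       \<Longrightarrow> Assoc T X Y Z \<in> Isos C ((X \<boxdot>\<^bsub>T\<^esub> Y) \<boxdot>\<^bsub>T\<^esub> Z) (X \<boxdot>\<^bsub>T\<^esub> (Y \<boxdot>\<^bsub>T\<^esub> Z))"
    and assoc_natural:
      "\<lbrakk>X \<in> Obj C; X' \<in> Obj C; Y \<in> Obj C; Y' \<in> Obj C; Z \<in> Obj C; Z' \<in> Obj C;
        f \<in> Hom C X X'; g \<in> Hom C Y Y'; h \<in> Hom C Z Z'\<rbrakk>
       \<Longrightarrow> Assoc T X' Y' Z' \<cdot> ((f \<boxtimes>\<^bsub>T\<^esub> g) \<boxtimes>\<^bsub>T\<^esub> h) = (f \<boxtimes>\<^bsub>T\<^esub> (g \<boxtimes>\<^bsub>T\<^esub> h)) \<cdot> Assoc T X Y Z"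
    and lunit_iso: "X \<in> Obj C \<Longrightarrow> LUnit T X \<in> Isos C (Unit T \<boxdot>\<^bsub>T\<^esub> X) X"
    and lunit_natural:
      "\<lbrakk>X \<in> Obj C; X' \<in> Obj C; f \<in> Hom C X X'\<rbrakk>
       \<Longrightarrow> LUnit T X' \<cdot> (Ident C (Unit T) \<boxtimes>\<^bsub>T\<^esub> f) = f \<cdot> LUnit T X"
    and runit_iso: "X \<in> Obj C \<Longrightarrow> RUnit T X \<in> Isos C (X \<boxdot>\<^bsub>T\<^esub> Unit T) X"
    and runit_natural:
      "\<lbrakk>X \<in> Obj C; X' \<in> Obj C; f \<in> Hom C X X'\<rbrakk>
       \<Longrightarrow> RUnit T X' \<cdot> (f \<boxtimes>\<^bsub>T\<^esub> Ident C (Unit T)) = f \<cdot> RUnit T X"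
    and pentagon:
      "\<lbrakk>W \<in> Obj C; X \<in> Obj C; Y \<in> Obj C; Z \<in> Obj C\<rbrakk>
       \<Longrightarrow> Assoc T W X (Y \<boxdot>\<^bsub>T\<^esub> Z) \<cdot> Assoc T (W \<boxdot>\<^bsub>T\<^esub> X) Y Z
         = (Ident C W \<boxtimes>\<^bsub>T\<^esub> Assoc T X Y Z) \<cdot> Assoc T W (X \<boxdot>\<^bsub>T\<^esub> Y) Z
           \<cdot> (Assoc T W X Y \<boxtimes>\<^bsub>T\<^esub> Ident C Z)"
    and triangle:
      "\<lbrakk>X \<in> Obj C; Y \<in> Obj C\<rbrakk>
       \<Longrightarrow> (Ident C X \<boxtimes>\<^bsub>T\<^esub> LUnit T Y) \<cdot> Assoc T X (Unit T) Y = RUnit T X \<boxtimes>\<^bsub>T\<^esub> Ident C Y"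

locale symmetric_monoidal_category = monoidal_category C T for C (structure) and T (structure) +
  assumes braid_iso:
      "\<lbrakk>X \<in> Obj C; Y \<in> Obj C\<rbrakk> \<Longrightarrow> Braid T X Y \<in> Isos C (X \<boxdot>\<^bsub>T\<^esub> Y) (Y \<boxdot>\<^bsub>T\<^esub> X)"
    and braid_natural:
      "\<lbrakk>X \<in> Obj C; X' \<in> Obj C; Y \<in> Obj C; Y' \<in> Obj C; f \<in> Hom C X X'; g \<in> Hom C Y Y'\<rbrakk>
       \<Longrightarrow> Braid T X' Y' \<cdot> (f \<boxtimes>\<^bsub>T\<^esub> g) = (g \<boxtimes>\<^bsub>T\<^esub> f) \<cdot> Braid T X Y"
    and symmetry:
      "\<lbrakk>X \<in> Obj C; Y \<in> Obj C\<rbrakk> \<Longrightarrow> Braid T Y X \<cdot> Braid T X Y = Ident C (X \<boxdot>\<^bsub>T\<^esub> Y)"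
    and hexagon:
      "\<lbrakk>X \<in> Obj C; Y \<in> Obj C; Z \<in> Obj C\<rbrakk>
       \<Longrightarrow> Assoc T Y Z X \<cdot> Braid T X (Y \<boxdot>\<^bsub>T\<^esub> Z) \<cdot> Assoc T X Y Z
         = (Ident C Y \<boxtimes>\<^bsub>T\<^esub> Braid T X Z) \<cdot> Assoc T Y X Z \<cdot> (Braid T X Y \<boxtimes>\<^bsub>T\<^esub> Ident C Z)"

text \<open>Closedness: for every \<open>Y\<close> the functor \<open>- \<otimes> Y\<close> has the right adjoint \<open>[Y, -]\<close>.\<close>

locale closed_symmetric_monoidal_category = symmetric_monoidal_category C T
  for C (structure) and T (structure) +
  assumes ihom_obj: "\<lbrakk>Y \<in> Obj C; Z \<in> Obj C\<rbrakk> \<Longrightarrow> IObj T Y Z \<in> Obj C"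
    and ihom_arr:
      "\<lbrakk>Y \<in> Obj C; Z \<in> Obj C; Z' \<in> Obj C; h \<in> Hom C Z Z'\<rbrakk>
       \<Longrightarrow> IArr T Y h \<in> Hom C (IObj T Y Z) (IObj T Y Z')"
    and ihom_ident:
      "\<lbrakk>Y \<in> Obj C; Z \<in> Obj C\<rbrakk> \<Longrightarrow> IArr T Y (Ident C Z) = Ident C (IObj T Y Z)"
    and ihom_comp:
      "\<lbrakk>Y \<in> Obj C; Z \<in> Obj C; Z' \<in> Obj C; Z'' \<in> Obj C; h \<in> Hom C Z Z'; h' \<in> Hom C Z' Z''\<rbrakk>
       \<Longrightarrow> IArr T Y (h' \<cdot> h) = IArr T Y h' \<cdot> IArr T Y h"
    and curry_bij:
      "\<lbrakk>X \<in> Obj C; Y \<in> Obj C; Z \<in> Obj C\<rbrakk>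
       \<Longrightarrow> bij_betw (Curry T X Y Z) (Hom C (X \<boxdot>\<^bsub>T\<^esub> Y) Z) (Hom C X (IObj T Y Z))"
    and curry_natural:
      "\<lbrakk>X \<in> Obj C; X' \<in> Obj C; Y \<in> Obj C; Z \<in> Obj C; Z' \<in> Obj C;
        g \<in> Hom C X' X; f \<in> Hom C (X \<boxdot>\<^bsub>T\<^esub> Y) Z; h \<in> Hom C Z Z'\<rbrakk>
       \<Longrightarrow> Curry T X' Y Z' (h \<cdot> f \<cdot> (g \<boxtimes>\<^bsub>T\<^esub> Ident C Y))
         = IArr T Y h \<cdot> Curry T X Y Z f \<cdot> g"


section \<open>The category of left modules\<close>

text \<open>The library's \<open>module\<close> locale requires a commutative ring of scalars. The record \<open>module\<close> also
  has the components \<open>mult\<close> and \<open>one\<close>, which are irrelevant for a module;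
  modules differing only there are isomorphic objects of the category below.\<close>

locale left_module = R?: ring R + M?: abelian_group M
  for R :: "('r, 'x) ring_scheme" (structure) and M :: "('r, 'm, 'y) module_scheme" (structure) +
  assumes smult_closed: "\<lbrakk>a \<in> carrier R; x \<in> carrier M\<rbrakk> \<Longrightarrow> a \<odot>\<^bsub>M\<^esub> x \<in> carrier M"
    and smult_l_distr:
      "\<lbrakk>a \<in> carrier R; b \<in> carrier R; x \<in> carrier M\<rbrakk>
       \<Longrightarrow> (a \<oplus>\<^bsub>R\<^esub> b) \<odot>\<^bsub>M\<^esub> x = a \<odot>\<^bsub>M\<^esub> x \<oplus>\<^bsub>M\<^esub> b \<odot>\<^bsub>M\<^esub> x"
    and smult_r_distr:
      "\<lbrakk>a \<in> carrier R; x \<in> carrier M; y \<in> carrier M\<rbrakk>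
       \<Longrightarrow> a \<odot>\<^bsub>M\<^esub> (x \<oplus>\<^bsub>M\<^esub> y) = a \<odot>\<^bsub>M\<^esub> x \<oplus>\<^bsub>M\<^esub> a \<odot>\<^bsub>M\<^esub> y"
    and smult_assoc1:
      "\<lbrakk>a \<in> carrier R; b \<in> carrier R; x \<in> carrier M\<rbrakk>
       \<Longrightarrow> (a \<otimes>\<^bsub>R\<^esub> b) \<odot>\<^bsub>M\<^esub> x = a \<odot>\<^bsub>M\<^esub> (b \<odot>\<^bsub>M\<^esub> x)"
    and smult_one: "x \<in> carrier M \<Longrightarrow> \<one>\<^bsub>R\<^esub> \<odot>\<^bsub>M\<^esub> x = x"

definition lin_maps ::
    "('r, 'x) ring_scheme \<Rightarrow> ('r, 'm) module \<Rightarrow> ('r, 'n) module \<Rightarrow> ('m \<Rightarrow> 'n) set" where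
  "lin_maps R M N = {f \<in> carrier M \<rightarrow>\<^sub>E carrier N.
      (\<forall>x \<in> carrier M. \<forall>y \<in> carrier M. f (x \<oplus>\<^bsub>M\<^esub> y) = f x \<oplus>\<^bsub>N\<^esub> f y) \<and>
      (\<forall>a \<in> carrier R. \<forall>x \<in> carrier M. f (a \<odot>\<^bsub>M\<^esub> x) = a \<odot>\<^bsub>N\<^esub> f x)}"

datatype ('o, 'f) arrow = Arrow (Src: 'o) (Trg: 'o) (Fn: 'f)

type_synonym ('r, 'm) mod_arrow = "(('r, 'm) module, 'm \<Rightarrow> 'm) arrow"

text \<open>HOL has no type of all modules, so size is handled with a universe: \<open>U\<close> is the collection of
  the small sets, and the objects are all left \<open>R\<close>-modules whose underlying set is small. No closure
  properties are built into \<open>U\<close>; the intended choices are universes such as the sets of cardinality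
  below a fixed infinite strong limit cardinal.\<close>

definition LMod ::
    "('r, 'x) ring_scheme \<Rightarrow> 'm set set \<Rightarrow> (('r, 'm) module, ('r, 'm) mod_arrow) cat" where
  "LMod R U = \<lparr>
     Obj = {M. left_module R M \<and> carrier M \<in> U},
     Hom = (\<lambda>M N. Arrow M N ` lin_maps R M N),
     Ident = (\<lambda>M. Arrow M M (\<lambda>x\<in>carrier M. x)),
     Comp = (\<lambda>g f. Arrow (Src f) (Trg g) (compose (carrier (Src f)) (Fn g) (Fn f)))\<rparr>"

definition small_in :: "'r set \<Rightarrow> 'm set set \<Rightarrow> bool" where
  "small_in A U \<longleftrightarrow> (\<exists>B \<in> U. \<exists>e. bij_betw e A B)"

definition arrow_add :: "('r, 'm) mod_arrow \<Rightarrow> ('r, 'm) mod_arrow \<Rightarrow> ('r, 'm) mod_arrow" where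
  "arrow_add f g = Arrow (Src f) (Trg f)
     (\<lambda>x\<in>carrier (Src f). Fn f x \<oplus>\<^bsub>Trg f\<^esub> Fn g x)"

text \<open>Additivity of the functors \<open>- \<otimes> Y\<close> and \<open>Y \<otimes> -\<close> for every \<open>Y\<close>.\<close>

definition additive_tensor ::
    "('r, 'x) ring_scheme \<Rightarrow> 'm set set
     \<Rightarrow> (('r, 'm) module, ('r, 'm) mod_arrow, 'z) monoidal_structure_scheme \<Rightarrow> bool" where
  "additive_tensor R U T \<longleftrightarrow>
     (\<forall>X \<in> Obj (LMod R U). \<forall>X' \<in> Obj (LMod R U). \<forall>Y \<in> Obj (LMod R U).
      \<forall>f \<in> Hom (LMod R U) X X'. \<forall>f' \<in> Hom (LMod R U) X X'.
        arrow_add f f' \<boxtimes>\<^bsub>T\<^esub> Ident (LMod R U) Y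
          = arrow_add (f \<boxtimes>\<^bsub>T\<^esub> Ident (LMod R U) Y) (f' \<boxtimes>\<^bsub>T\<^esub> Ident (LMod R U) Y) \<and>
        Ident (LMod R U) Y \<boxtimes>\<^bsub>T\<^esub> arrow_add f f'
          = arrow_add (Ident (LMod R U) Y \<boxtimes>\<^bsub>T\<^esub> f) (Ident (LMod R U) Y \<boxtimes>\<^bsub>T\<^esub> f'))"


section \<open>Endomorphism rings and centers\<close>

definition End_ring :: "('r, 'x) ring_scheme \<Rightarrow> ('r, 'm) module \<Rightarrow> ('m \<Rightarrow> 'm) ring" where
  "End_ring R M = \<lparr>
     carrier = lin_maps R M M,
     mult = compose (carrier M),
     one = (\<lambda>x\<in>carrier M. x),
     zero = (\<lambda>x\<in>carrier M. \<zero>\<^bsub>M\<^esub>),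
     add = (\<lambda>f g. \<lambda>x\<in>carrier M. f x \<oplus>\<^bsub>M\<^esub> g x)\<rparr>"

definition center_ring :: "('r, 'x) ring_scheme \<Rightarrow> ('r, 'x) ring_scheme" where
  "center_ring R =
     R\<lparr>carrier := {z \<in> carrier R. \<forall>r \<in> carrier R. z \<otimes>\<^bsub>R\<^esub> r = r \<otimes>\<^bsub>R\<^esub> z}\<rparr>"


section \<open>Basic facts\<close>

lemma lin_maps_ident: "(\<lambda>x\<in>carrier M. x) \<in> lin_maps R M M"
  if "left_module R M"
proof -
  interpret left_module R M by fact
  show ?thesis by (auto simp: lin_maps_def smult_closed)
qed

lemma lin_maps_compose:
  assumes "left_module R M" "f \<in> lin_maps R M N" "g \<in> lin_maps R N P"
  shows "compose (carrier M) g f \<in> lin_maps R M P"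
proof -
  interpret left_module R M by fact
  have "f x \<in> carrier N" if "x \<in> carrier M" for x
    using that assms(2) by (auto simp: lin_maps_def)
  then show ?thesis
    using assms(2,3) by (auto simp: lin_maps_def compose_def smult_closed PiE_iff)
qed

lemma category_LMod: "category (LMod R U)"
proof
  show "Comp (LMod R U) g f \<in> Hom (LMod R U) X Z"
    if "X \<in> Obj (LMod R U)" "f \<in> Hom (LMod R U) X Y" "g \<in> Hom (LMod R U) Y Z" for X Y Z f g
    using that by (auto simp: LMod_def intro!: lin_maps_compose)
  show "Comp (LMod R U) f (Ident (LMod R U) X) = f"
    if "f \<in> Hom (LMod R U) X Y" for X Y f
    using that by (auto simp: LMod_def lin_maps_def compose_def fun_eq_iff PiE_iff
        restrict_def extensional_def)
  show "Comp (LMod R U) (Ident (LMod R U) Y) f = f"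
    if "f \<in> Hom (LMod R U) X Y" for X Y f
    using that by (auto simp: LMod_def lin_maps_def compose_def fun_eq_iff PiE_iff
        restrict_def extensional_def)
  show "Comp (LMod R U) (Comp (LMod R U) h g) f = Comp (LMod R U) h (Comp (LMod R U) g f)"
    if "f \<in> Hom (LMod R U) W X" "g \<in> Hom (LMod R U) X Y" "h \<in> Hom (LMod R U) Y Z"
    for W X Y Z f g h
    using that by (auto simp: LMod_def lin_maps_def compose_def fun_eq_iff PiE_iff
        restrict_def)
qed (auto simp: LMod_def lin_maps_ident)

lemma ring_End_ring:
  assumes "left_module R M"
  shows "ring (End_ring R M)"
proof -
  interpret left_module R M by fact
  have neg: "(\<lambda>x\<in>carrier M. \<ominus>\<^bsub>M\<^esub> f x) \<in> lin_maps R M M" if f: "f \<in> lin_maps R M M" for f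
  proof -
    have mn: "a \<odot>\<^bsub>M\<^esub> (\<ominus>\<^bsub>M\<^esub> x) = \<ominus>\<^bsub>M\<^esub> (a \<odot>\<^bsub>M\<^esub> x)"
      if "a \<in> carrier R" "x \<in> carrier M" for a x
    proof -
      have z: "a \<odot>\<^bsub>M\<^esub> \<zero>\<^bsub>M\<^esub> = \<zero>\<^bsub>M\<^esub>"
        using smult_r_distr[OF that(1), of "\<zero>\<^bsub>M\<^esub>" "\<zero>\<^bsub>M\<^esub>"] smult_closed[OF that(1), of "\<zero>\<^bsub>M\<^esub>"]
        by simp
      have "a \<odot>\<^bsub>M\<^esub> (\<ominus>\<^bsub>M\<^esub> x) \<oplus>\<^bsub>M\<^esub> a \<odot>\<^bsub>M\<^esub> x = \<zero>\<^bsub>M\<^esub>"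
        using smult_r_distr[OF that(1), of "\<ominus>\<^bsub>M\<^esub> x" x] that z by (simp add: M.l_neg)
      then show ?thesis
        using that by (intro M.minus_equality[symmetric]) (auto simp: smult_closed)
    qed
    have fc: "f x \<in> carrier M" if "x \<in> carrier M" for x
      using f that by (auto simp: lin_maps_def)
    show ?thesis
      using f unfolding lin_maps_def
      by (simp add: PiE_iff fc smult_closed mn M.minus_add)
  qed
  have z: "a \<odot>\<^bsub>M\<^esub> \<zero>\<^bsub>M\<^esub> = \<zero>\<^bsub>M\<^esub>" if "a \<in> carrier R" for a
    using smult_r_distr[OF that, of "\<zero>\<^bsub>M\<^esub>" "\<zero>\<^bsub>M\<^esub>"] smult_closed[OF that, of "\<zero>\<^bsub>M\<^esub>"] by simp
  show ?thesis
  proof (rule ringI)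
    show "abelian_group (End_ring R M)"
    proof (rule abelian_groupI)
      fix f assume "f \<in> carrier (End_ring R M)"
      then have f: "f \<in> lin_maps R M M"
        by (simp add: End_ring_def)
      then have "f x \<in> carrier M" if "x \<in> carrier M" for x
        using that by (auto simp: lin_maps_def)
      then show "\<exists>g\<in>carrier (End_ring R M). g \<oplus>\<^bsub>End_ring R M\<^esub> f = \<zero>\<^bsub>End_ring R M\<^esub>"
        using neg[OF f] by (intro bexI[of _ "\<lambda>x\<in>carrier M. \<ominus>\<^bsub>M\<^esub> f x"])
          (auto simp: End_ring_def fun_eq_iff M.l_neg)
    qed (auto simp: End_ring_def lin_maps_def PiE_iff smult_closed smult_r_distr z fun_eq_iff
        extensional_def M.a_ac)
    show "monoid (End_ring R M)"
    proof (rule monoidI)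
      show "x \<otimes>\<^bsub>End_ring R M\<^esub> y \<in> carrier (End_ring R M)"
        if "x \<in> carrier (End_ring R M)" "y \<in> carrier (End_ring R M)" for x y
        using that assms by (auto simp: End_ring_def intro!: lin_maps_compose)
      show "\<one>\<^bsub>End_ring R M\<^esub> \<in> carrier (End_ring R M)"
        using assms by (simp add: End_ring_def lin_maps_ident)
    qed (auto simp: End_ring_def lin_maps_def compose_def PiE_iff fun_eq_iff extensional_def)
  qed (auto simp: End_ring_def lin_maps_def compose_def PiE_iff fun_eq_iff)
qed

end

theory Submission
  imports Defs
begin

text \<open>An endomorphism \<open>\<phi>\<close> of the unit \<open>K\<close> acts on every object \<open>X \<cong> K \<otimes> X\<close> through \<open>\<phi> \<otimes> X\<close>, and
  naturally so. A natural endomorphism of the identity functor on left \<open>R\<close>-modules is determined by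
  its value at \<open>1\<close> in the regular module and is multiplication by a central element. The resulting
  map \<open>End K \<rightarrow> Z R\<close> is a ring homomorphism because the tensor product is additive. It is injective
  because the action on \<open>K\<close> itself recovers \<open>\<phi> \<otimes> K\<close>, to which \<open>\<phi>\<close> is conjugate by the right unitor.\<close>

section \<open>Cancellation of isomorphisms\<close>

context category
begin

lemma Isos_cancel_right:
  assumes "X \<in> Obj C" "Y \<in> Obj C" "Z \<in> Obj C" "i \<in> Isos C X Y"
    and "f \<in> Hom C Y Z" "g \<in> Hom C Y Z" "f \<cdot> i = g \<cdot> i"
  shows "f = g"
proof -
  obtain j where ij: "i \<in> Hom C X Y" "j \<in> Hom C Y X" "i \<cdot> j = Ident C Y"
    using assms(4) unfolding Isos_def by blast
  have "f = (f \<cdot> i) \<cdot> j"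
    using assms ij comp_assoc[of Y X Y Z j i f] comp_ident_right[of Y Z f] by simp
  also have "\<dots> = g"
    using assms ij comp_assoc[of Y X Y Z j i g] comp_ident_right[of Y Z g] by simp
  finally show ?thesis .
qed

lemma Isos_cancel_left:
  assumes "X \<in> Obj C" "Y \<in> Obj C" "Z \<in> Obj C" "i \<in> Isos C X Y"
    and "f \<in> Hom C Z X" "g \<in> Hom C Z X" "i \<cdot> f = i \<cdot> g"
  shows "f = g"
proof -
  obtain j where ij: "i \<in> Hom C X Y" "j \<in> Hom C Y X" "j \<cdot> i = Ident C X"
    using assms(4) unfolding Isos_def by blast
  have "f = j \<cdot> (i \<cdot> f)"
    using assms ij comp_assoc[of Z X Y X f i j] comp_ident_left[of Z X f] by simp
  also have "\<dots> = g"
    using assms ij comp_assoc[of Z X Y X g i j] comp_ident_left[of Z X g] by simp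
  finally show ?thesis .
qed

end

section \<open>The action of endomorphisms of the unit on all objects\<close>

context monoidal_category
begin

text \<open>\<open>Isos\<close> only asserts that some inverse exists, so one is picked; inverses
  being unique, the choice does not affect the action.\<close>

definition lunit_inv :: "'a \<Rightarrow> 'b" where
  "lunit_inv X = (SOME g. g \<in> Hom C X (Unit T \<boxdot>\<^bsub>T\<^esub> X) \<and>
     g \<cdot> LUnit T X = Ident C (Unit T \<boxdot>\<^bsub>T\<^esub> X) \<and> LUnit T X \<cdot> g = Ident C X)"

definition unit_act :: "'b \<Rightarrow> 'a \<Rightarrow> 'b" where
  "unit_act \<phi> X = LUnit T X \<cdot> (\<phi> \<boxtimes>\<^bsub>T\<^esub> Ident C X) \<cdot> lunit_inv X"

lemma
  assumes "X \<in> Obj C"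
  shows lunit_hom: "LUnit T X \<in> Hom C (Unit T \<boxdot>\<^bsub>T\<^esub> X) X"
    and lunit_inv_hom: "lunit_inv X \<in> Hom C X (Unit T \<boxdot>\<^bsub>T\<^esub> X)"
    and lunit_inv_left: "lunit_inv X \<cdot> LUnit T X = Ident C (Unit T \<boxdot>\<^bsub>T\<^esub> X)"
proof -
  show "LUnit T X \<in> Hom C (Unit T \<boxdot>\<^bsub>T\<^esub> X) X"
    using lunit_iso[OF assms] unfolding Isos_def by blast
  have "\<exists>g. g \<in> Hom C X (Unit T \<boxdot>\<^bsub>T\<^esub> X) \<and>
     g \<cdot> LUnit T X = Ident C (Unit T \<boxdot>\<^bsub>T\<^esub> X) \<and> LUnit T X \<cdot> g = Ident C X"
    using lunit_iso[OF assms] unfolding Isos_def by blast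
  from someI_ex[OF this, folded lunit_inv_def]
  show "lunit_inv X \<in> Hom C X (Unit T \<boxdot>\<^bsub>T\<^esub> X)"
    "lunit_inv X \<cdot> LUnit T X = Ident C (Unit T \<boxdot>\<^bsub>T\<^esub> X)"
    by blast+
qed

lemma unit_tensor_obj: "X \<in> Obj C \<Longrightarrow> Unit T \<boxdot>\<^bsub>T\<^esub> X \<in> Obj C"
  by (simp add: tensor_obj unit_obj)

lemma unit_tensor_hom:
  "\<lbrakk>X \<in> Obj C; \<phi> \<in> Hom C (Unit T) (Unit T)\<rbrakk>
   \<Longrightarrow> \<phi> \<boxtimes>\<^bsub>T\<^esub> Ident C X \<in> Hom C (Unit T \<boxdot>\<^bsub>T\<^esub> X) (Unit T \<boxdot>\<^bsub>T\<^esub> X)"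
  by (simp add: tensor_arr unit_obj ident_hom)

lemma unit_act_hom:
  assumes X: "X \<in> Obj C" and \<phi>: "\<phi> \<in> Hom C (Unit T) (Unit T)"
  shows "unit_act \<phi> X \<in> Hom C X X"
  unfolding unit_act_def
  using unit_tensor_obj[OF X] unit_tensor_hom[OF X \<phi>] lunit_hom[OF X] lunit_inv_hom[OF X] X
    comp_hom by metis

text \<open>Precomposing with the unitor absorbs the chosen inverse. The categorical lemmas below
  work with this inverse-free equation.\<close>

lemma unit_act_lunit:
  assumes X: "X \<in> Obj C" and \<phi>: "\<phi> \<in> Hom C (Unit T) (Unit T)"
  shows "unit_act \<phi> X \<cdot> LUnit T X = LUnit T X \<cdot> (\<phi> \<boxtimes>\<^bsub>T\<^esub> Ident C X)"
proof -
  let ?KX = "Unit T \<boxdot>\<^bsub>T\<^esub> X"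
  let ?m = "LUnit T X \<cdot> (\<phi> \<boxtimes>\<^bsub>T\<^esub> Ident C X)"
  have m: "?m \<in> Hom C ?KX X"
    using comp_hom[OF unit_tensor_obj unit_tensor_obj _ unit_tensor_hom lunit_hom] X \<phi> by blast
  have "unit_act \<phi> X \<cdot> LUnit T X = ?m \<cdot> (lunit_inv X \<cdot> LUnit T X)"
    unfolding unit_act_def
    using comp_assoc[OF unit_tensor_obj X unit_tensor_obj X lunit_hom lunit_inv_hom m] X by blast
  also have "\<dots> = ?m"
    using X by (simp add: lunit_inv_left comp_ident_right[OF unit_tensor_obj X m])
  finally show ?thesis .
qed

text \<open>The unitor is invertible, hence cancellable on the right, so the equation of
  \<open>unit_act_lunit\<close> determines the action. Compatibility with identities and composition
  then only needs this equation for the expected candidate.\<close>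

lemma unit_act_unique:
  assumes X: "X \<in> Obj C" and \<phi>: "\<phi> \<in> Hom C (Unit T) (Unit T)" and f: "f \<in> Hom C X X"
    and eq: "f \<cdot> LUnit T X = LUnit T X \<cdot> (\<phi> \<boxtimes>\<^bsub>T\<^esub> Ident C X)"
  shows "unit_act \<phi> X = f"
  by (rule Isos_cancel_right[OF unit_tensor_obj[OF X] X X lunit_iso[OF X]])
    (simp_all add: unit_act_hom unit_act_lunit X \<phi> f eq)

text \<open>After precomposition with \<open>LUnit T X\<close>, the naturality of the left unitor
  reduces the claim to the interchange law: \<phi> acts on the first tensor factor and
  \<open>f\<close> on the second, so their order is immaterial.\<close>

lemma unit_act_natural:
  assumes X: "X \<in> Obj C" and Y: "Y \<in> Obj C" and f: "f \<in> Hom C X Y"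
    and \<phi>: "\<phi> \<in> Hom C (Unit T) (Unit T)"
  shows "unit_act \<phi> Y \<cdot> f = f \<cdot> unit_act \<phi> X"
proof (rule Isos_cancel_right[OF unit_tensor_obj[OF X] X Y lunit_iso[OF X]])
  let ?K = "Unit T"
  note objs = X Y unit_obj unit_tensor_obj[OF X] unit_tensor_obj[OF Y]
  note homs = f \<phi> unit_act_hom[OF X \<phi>] unit_act_hom[OF Y \<phi>] lunit_hom[OF X] lunit_hom[OF Y]
    unit_tensor_hom[OF X \<phi>] unit_tensor_hom[OF Y \<phi>] ident_hom[OF X] ident_hom[OF Y]
    ident_hom[OF unit_obj]
  have Kf: "Ident C ?K \<boxtimes>\<^bsub>T\<^esub> f \<in> Hom C (?K \<boxdot>\<^bsub>T\<^esub> X) (?K \<boxdot>\<^bsub>T\<^esub> Y)"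
    using tensor_arr objs homs by blast
  show "unit_act \<phi> Y \<cdot> f \<in> Hom C X Y" "f \<cdot> unit_act \<phi> X \<in> Hom C X Y"
    using comp_hom objs homs by blast+
  have "unit_act \<phi> Y \<cdot> f \<cdot> LUnit T X = unit_act \<phi> Y \<cdot> (f \<cdot> LUnit T X)"
    using comp_assoc objs homs by blast
  also have "\<dots> = unit_act \<phi> Y \<cdot> (LUnit T Y \<cdot> (Ident C ?K \<boxtimes>\<^bsub>T\<^esub> f))"
    using lunit_natural[OF X Y f] by simp
  also have "\<dots> = unit_act \<phi> Y \<cdot> LUnit T Y \<cdot> (Ident C ?K \<boxtimes>\<^bsub>T\<^esub> f)"
    using comp_assoc[OF objs(4) objs(5) Y Y Kf homs(6) homs(4)] by simp
  also have "\<dots> = LUnit T Y \<cdot> (\<phi> \<boxtimes>\<^bsub>T\<^esub> Ident C Y) \<cdot> (Ident C ?K \<boxtimes>\<^bsub>T\<^esub> f)"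
    by (simp add: unit_act_lunit Y \<phi>)
  also have "\<dots> = LUnit T Y \<cdot> ((\<phi> \<boxtimes>\<^bsub>T\<^esub> Ident C Y) \<cdot> (Ident C ?K \<boxtimes>\<^bsub>T\<^esub> f))"
    using comp_assoc[OF objs(4) objs(5) objs(5) Y Kf homs(8) homs(6)] by simp
  \<comment> \<open>Both composites are factorizations of \<phi> tensored with \<open>f\<close>;
    this step and the next one pass through that common arrow.\<close>
  also have "(\<phi> \<boxtimes>\<^bsub>T\<^esub> Ident C Y) \<cdot> (Ident C ?K \<boxtimes>\<^bsub>T\<^esub> f) = \<phi> \<boxtimes>\<^bsub>T\<^esub> f"
    using tensor_comp[OF unit_obj unit_obj unit_obj X Y Y homs(11) \<phi> f homs(10)]
      comp_ident_right[OF unit_obj unit_obj \<phi>] comp_ident_left[OF X Y f] by simp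
  also have "\<phi> \<boxtimes>\<^bsub>T\<^esub> f = (Ident C ?K \<boxtimes>\<^bsub>T\<^esub> f) \<cdot> (\<phi> \<boxtimes>\<^bsub>T\<^esub> Ident C X)"
    using tensor_comp[OF unit_obj unit_obj unit_obj X X Y \<phi> homs(11) homs(9) f]
      comp_ident_left[OF unit_obj unit_obj \<phi>] comp_ident_right[OF X Y f] by simp
  also have "LUnit T Y \<cdot> ((Ident C ?K \<boxtimes>\<^bsub>T\<^esub> f) \<cdot> (\<phi> \<boxtimes>\<^bsub>T\<^esub> Ident C X))
      = LUnit T Y \<cdot> (Ident C ?K \<boxtimes>\<^bsub>T\<^esub> f) \<cdot> (\<phi> \<boxtimes>\<^bsub>T\<^esub> Ident C X)"
    using comp_assoc[OF objs(4) objs(4) objs(5) Y homs(7) Kf homs(6)] by simp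
  also have "\<dots> = f \<cdot> LUnit T X \<cdot> (\<phi> \<boxtimes>\<^bsub>T\<^esub> Ident C X)"
    using lunit_natural[OF X Y f] by simp
  also have "\<dots> = f \<cdot> (unit_act \<phi> X \<cdot> LUnit T X)"
    using comp_assoc[OF objs(4) objs(4) X Y homs(7) homs(5) f] by (simp add: unit_act_lunit X \<phi>)
  also have "\<dots> = f \<cdot> unit_act \<phi> X \<cdot> LUnit T X"
    using comp_assoc[OF objs(4) X X Y homs(5) homs(3) f] by simp
  finally show "unit_act \<phi> Y \<cdot> f \<cdot> LUnit T X = f \<cdot> unit_act \<phi> X \<cdot> LUnit T X" .
qed

lemma unit_act_ident: "X \<in> Obj C \<Longrightarrow> unit_act (Ident C (Unit T)) X = Ident C X"
  by (rule unit_act_unique)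
    (simp_all add: ident_hom unit_obj tensor_ident comp_ident_left[OF _ _ lunit_hom]
      comp_ident_right[OF _ _ lunit_hom] unit_tensor_obj)

text \<open>By uniqueness it suffices to move the unitor past \<psi> and then past \<phi>;
  functoriality of tensoring with \<open>X\<close> merges the two remaining factors.\<close>

lemma unit_act_comp:
  assumes X: "X \<in> Obj C" and \<phi>: "\<phi> \<in> Hom C (Unit T) (Unit T)"
    and \<psi>: "\<psi> \<in> Hom C (Unit T) (Unit T)"
  shows "unit_act (\<phi> \<cdot> \<psi>) X = unit_act \<phi> X \<cdot> unit_act \<psi> X"
proof (rule unit_act_unique[OF X])
  let ?KX = "Unit T \<boxdot>\<^bsub>T\<^esub> X"
  note KX = unit_tensor_obj[OF X]
  note l = lunit_hom[OF X]
  note a = unit_act_hom[OF X \<phi>] unit_act_hom[OF X \<psi>]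
  note t = unit_tensor_hom[OF X \<phi>] unit_tensor_hom[OF X \<psi>]
  show "\<phi> \<cdot> \<psi> \<in> Hom C (Unit T) (Unit T)"
    using comp_hom unit_obj \<phi> \<psi> by blast
  show "unit_act \<phi> X \<cdot> unit_act \<psi> X \<in> Hom C X X"
    using comp_hom X a by blast
  have "unit_act \<phi> X \<cdot> unit_act \<psi> X \<cdot> LUnit T X
      = unit_act \<phi> X \<cdot> (LUnit T X \<cdot> (\<psi> \<boxtimes>\<^bsub>T\<^esub> Ident C X))"
    using comp_assoc[OF KX X X X l a(2) a(1)] by (simp add: unit_act_lunit X \<psi>)
  also have "\<dots> = LUnit T X \<cdot> (\<phi> \<boxtimes>\<^bsub>T\<^esub> Ident C X) \<cdot> (\<psi> \<boxtimes>\<^bsub>T\<^esub> Ident C X)"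
    using comp_assoc[OF KX KX X X t(2) l a(1)] by (simp add: unit_act_lunit X \<phi>)
  also have "\<dots> = LUnit T X \<cdot> ((\<phi> \<boxtimes>\<^bsub>T\<^esub> Ident C X) \<cdot> (\<psi> \<boxtimes>\<^bsub>T\<^esub> Ident C X))"
    using comp_assoc[OF KX KX KX X t(2) t(1) l] by simp
  also have "(\<phi> \<boxtimes>\<^bsub>T\<^esub> Ident C X) \<cdot> (\<psi> \<boxtimes>\<^bsub>T\<^esub> Ident C X) = (\<phi> \<cdot> \<psi>) \<boxtimes>\<^bsub>T\<^esub> Ident C X"
    using tensor_comp[OF unit_obj unit_obj unit_obj X X X \<psi> \<phi> ident_hom[OF X] ident_hom[OF X]]
      comp_ident_left[OF X X ident_hom[OF X]] by simp
  finally show "unit_act \<phi> X \<cdot> unit_act \<psi> X \<cdot> LUnit T X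
      = LUnit T X \<cdot> ((\<phi> \<cdot> \<psi>) \<boxtimes>\<^bsub>T\<^esub> Ident C X)" .
qed

text \<open>The two unitors at the unit need not be compared: \<open>LUnit\<close> is only cancelled, leaving
  \<open>\<phi> \<otimes> K = \<psi> \<otimes> K\<close>, and \<open>RUnit\<close> turns this into \<open>\<phi> = \<psi>\<close>.\<close>

lemma unit_act_inject:
  assumes \<phi>: "\<phi> \<in> Hom C (Unit T) (Unit T)" and \<psi>: "\<psi> \<in> Hom C (Unit T) (Unit T)"
    and eq: "unit_act \<phi> (Unit T) = unit_act \<psi> (Unit T)"
  shows "\<phi> = \<psi>"
proof -
  note K = unit_obj
  note KK = unit_tensor_obj[OF K]
  have "\<phi> \<boxtimes>\<^bsub>T\<^esub> Ident C (Unit T) = \<psi> \<boxtimes>\<^bsub>T\<^esub> Ident C (Unit T)"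
    by (rule Isos_cancel_left[OF KK K KK lunit_iso[OF K]])
      (simp_all add: unit_tensor_hom K \<phi> \<psi> eq flip: unit_act_lunit)
  then have "\<phi> \<cdot> RUnit T (Unit T) = \<psi> \<cdot> RUnit T (Unit T)"
    using runit_natural[OF K K \<phi>] runit_natural[OF K K \<psi>] by simp
  then show ?thesis
    using Isos_cancel_right[OF KK K K runit_iso[OF K] \<phi> \<psi>] by blast
qed

end

section \<open>Elementwise computation with arrows between modules\<close>

lemma Obj_LMod: "X \<in> Obj (LMod R U) \<longleftrightarrow> left_module R X \<and> carrier X \<in> U"
  by (simp add: LMod_def)

lemma Hom_LMod: "Hom (LMod R U) X Y = Arrow X Y ` lin_maps R X Y"
  by (simp add: LMod_def)

lemma Fn_Ident_LMod: "x \<in> carrier X \<Longrightarrow> Fn (Ident (LMod R U) X) x = x"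
  by (simp add: LMod_def)

lemma Fn_Comp_LMod:
  "\<lbrakk>f \<in> Hom (LMod R U) X Y; x \<in> carrier X\<rbrakk> \<Longrightarrow> Fn (Comp (LMod R U) g f) x = Fn g (Fn f x)"
  by (auto simp: LMod_def compose_def)

lemma Fn_closed: "\<lbrakk>f \<in> Hom (LMod R U) X Y; x \<in> carrier X\<rbrakk> \<Longrightarrow> Fn f x \<in> carrier Y"
  by (auto simp: Hom_LMod lin_maps_def)

lemma Fn_smult:
  "\<lbrakk>f \<in> Hom (LMod R U) X Y; a \<in> carrier R; x \<in> carrier X\<rbrakk>
   \<Longrightarrow> Fn f (a \<odot>\<^bsub>X\<^esub> x) = a \<odot>\<^bsub>Y\<^esub> Fn f x"
  by (auto simp: Hom_LMod lin_maps_def)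

lemma Fn_add:
  "\<lbrakk>f \<in> Hom (LMod R U) X Y; x \<in> carrier X; y \<in> carrier X\<rbrakk>
   \<Longrightarrow> Fn f (x \<oplus>\<^bsub>X\<^esub> y) = Fn f x \<oplus>\<^bsub>Y\<^esub> Fn f y"
  by (auto simp: Hom_LMod lin_maps_def)

lemma Fn_arrow_add:
  "\<lbrakk>f \<in> Hom (LMod R U) X Y; x \<in> carrier X\<rbrakk> \<Longrightarrow> Fn (arrow_add f g) x = Fn f x \<oplus>\<^bsub>Y\<^esub> Fn g x"
  by (auto simp: Hom_LMod arrow_add_def)

text \<open>Arrows in one hom-set share source and target, and their functions are extensional, so
  the values on the carrier decide equality.\<close>

lemma Hom_LMod_eqI:
  assumes "f \<in> Hom (LMod R U) X Y" "g \<in> Hom (LMod R U) X Y"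
    and "\<And>x. x \<in> carrier X \<Longrightarrow> Fn f x = Fn g x"
  shows "f = g"
  using assms unfolding Hom_LMod lin_maps_def
  by (auto intro: PiE_ext)

text \<open>This is the regular left module, carried along \<open>e\<close> onto its image. The
  transport is there because the objects of \<open>LMod R U\<close> live on the type
  \<open>'m\<close> and have their carrier in \<open>U\<close>, whereas the elements of
  \<open>R\<close> have type \<open>'r\<close>.\<close>

definition transported_module ::
    "('r, 'x) ring_scheme \<Rightarrow> ('r \<Rightarrow> 'm) \<Rightarrow> ('r, 'm) module" where
  "transported_module R e = (let d = the_inv_into (carrier R) e in
     \<lparr>carrier = e ` carrier R, mult = (\<lambda>_ _. undefined), one = undefined, zero = e \<zero>\<^bsub>R\<^esub>,
      add = (\<lambda>x y. e (d x \<oplus>\<^bsub>R\<^esub> d y)), smult = (\<lambda>a x. e (a \<otimes>\<^bsub>R\<^esub> d x))\<rparr>)"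

lemma transported_module_simps:
  assumes "inj_on e (carrier R)"
  shows "carrier (transported_module R e) = e ` carrier R"
    and "\<zero>\<^bsub>transported_module R e\<^esub> = e \<zero>\<^bsub>R\<^esub>"
    and "\<lbrakk>r \<in> carrier R; s \<in> carrier R\<rbrakk> \<Longrightarrow> e r \<oplus>\<^bsub>transported_module R e\<^esub> e s = e (r \<oplus>\<^bsub>R\<^esub> s)"
    and "s \<in> carrier R \<Longrightarrow> r \<odot>\<^bsub>transported_module R e\<^esub> e s = e (r \<otimes>\<^bsub>R\<^esub> s)"
  using assms by (simp_all add: transported_module_def Let_def the_inv_into_f_f)

lemma left_module_transported_module:
  assumes "ring R" "inj_on e (carrier R)"
  shows "left_module R (transported_module R e)"
proof -
  interpret ring R by fact
  note simps = transported_module_simps[OF assms(2)]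
  have "abelian_group (transported_module R e)"
  proof (rule abelian_groupI)
    fix x assume "x \<in> carrier (transported_module R e)"
    then obtain r where "r \<in> carrier R" "x = e r" by (auto simp: simps)
    then show "\<exists>y\<in>carrier (transported_module R e).
        y \<oplus>\<^bsub>transported_module R e\<^esub> x = \<zero>\<^bsub>transported_module R e\<^esub>"
      by (intro bexI[of _ "e (\<ominus>\<^bsub>R\<^esub> r)"]) (auto simp: simps l_neg)
  qed (auto simp: simps a_ac)
  then show ?thesis
    by (intro left_module.intro left_module_axioms.intro assms)
      (auto simp: simps l_distr r_distr m_assoc)
qed

text \<open>A Yoneda argument: every element \<open>x\<close> of a module is the image of 1 under
  the linear map from the regular module that sends \<open>r\<close> to \<open>r\<close> times
  \<open>x\<close>. Naturality along this map transfers the value of \<alpha> at 1 to every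
  \<open>x\<close>.\<close>

lemma natural_endomorphism_central:
  assumes R: "ring R" and U: "small_in (carrier R) U"
    and hom: "\<And>X. X \<in> Obj (LMod R U) \<Longrightarrow> \<alpha> X \<in> Hom (LMod R U) X X"
    and natural: "\<And>X Y f. \<lbrakk>X \<in> Obj (LMod R U); Y \<in> Obj (LMod R U); f \<in> Hom (LMod R U) X Y\<rbrakk>
      \<Longrightarrow> Comp (LMod R U) (\<alpha> Y) f = Comp (LMod R U) f (\<alpha> X)"
  shows "\<exists>z \<in> carrier (center_ring R).
    \<forall>X \<in> Obj (LMod R U). \<forall>x \<in> carrier X. Fn (\<alpha> X) x = z \<odot>\<^bsub>X\<^esub> x"
proof -
  interpret ring R by fact
  obtain B e where B: "B \<in> U" "bij_betw e (carrier R) B"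
    using U unfolding small_in_def by blast
  then have inj: "inj_on e (carrier R)" and im: "e ` carrier R = B"
    by (auto simp: bij_betw_def)
  \<comment> \<open>Smallness of the ring is what places a copy of its regular module among the
    objects.\<close>
  define G where "G = transported_module R e"
  note G_simps = transported_module_simps[OF inj, folded G_def]
  have G: "G \<in> Obj (LMod R U)"
    using left_module_transported_module[OF R inj] B im
    by (simp add: Obj_LMod G_simps flip: G_def)
  have "Fn (\<alpha> G) (e \<one>\<^bsub>R\<^esub>) \<in> e ` carrier R"
    using Fn_closed[OF hom[OF G], of "e \<one>\<^bsub>R\<^esub>"] by (simp add: G_simps)
  then obtain z where z: "z \<in> carrier R" "Fn (\<alpha> G) (e \<one>\<^bsub>R\<^esub>) = e z" by blast
  have act: "Fn (\<alpha> X) x = z \<odot>\<^bsub>X\<^esub> x" if X: "X \<in> Obj (LMod R U)" and x: "x \<in> carrier X" for X x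
  proof -
    interpret left_module R X using X by (simp add: Obj_LMod)
    \<comment> \<open>The linear map that sends the generator \<open>e\<close> of 1 to
      \<open>x\<close>.\<close>
    define f where "f = Arrow G X (\<lambda>y\<in>carrier G. the_inv_into (carrier R) e y \<odot>\<^bsub>X\<^esub> x)"
    have Fn_f: "Fn f (e r) = r \<odot>\<^bsub>X\<^esub> x" if "r \<in> carrier R" for r
      using that inj by (simp add: f_def G_simps the_inv_into_f_f)
    have f: "f \<in> Hom (LMod R U) G X"
      using x inj unfolding f_def Hom_LMod lin_maps_def
      by (intro imageI)
        (auto simp: G_simps the_inv_into_f_f smult_closed smult_l_distr smult_assoc1)
    have "Fn (\<alpha> X) x = Fn (Comp (LMod R U) (\<alpha> X) f) (e \<one>\<^bsub>R\<^esub>)"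
      using x by (simp add: Fn_Comp_LMod[OF f] G_simps Fn_f smult_one)
    also have "\<dots> = Fn (Comp (LMod R U) f (\<alpha> G)) (e \<one>\<^bsub>R\<^esub>)"
      using natural[OF G X f] by simp
    also have "\<dots> = z \<odot>\<^bsub>X\<^esub> x"
      using z by (simp add: Fn_Comp_LMod[OF hom[OF G]] G_simps Fn_f)
    finally show ?thesis .
  qed
  \<comment> \<open>The value of \<open>\<alpha> G\<close> at \<open>e r\<close> is computed twice:
    as the action of \<open>z\<close>, and by linearity from the value at the generator.\<close>
  have "z \<otimes>\<^bsub>R\<^esub> r = r \<otimes>\<^bsub>R\<^esub> z" if r: "r \<in> carrier R" for r
  proof -
    have "e (z \<otimes>\<^bsub>R\<^esub> r) = Fn (\<alpha> G) (e r)"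
      using act[OF G, of "e r"] r by (simp add: G_simps)
    also have "\<dots> = e (r \<otimes>\<^bsub>R\<^esub> z)"
      using Fn_smult[OF hom[OF G] r, of "e \<one>\<^bsub>R\<^esub>"] r z by (simp add: G_simps)
    finally show ?thesis
      using inj r z by (simp add: inj_on_def)
  qed
  then show ?thesis
    using z act by (auto simp: center_ring_def)
qed

text \<open>The regular module is faithful: acting on its generator recovers the scalar. Identities
  between scalars can thus be checked on modules.\<close>

lemma smult_eq_cancel:
  assumes R: "ring R" and U: "small_in (carrier R) U"
    and "a \<in> carrier R" "b \<in> carrier R"
    and eq: "\<And>X x. \<lbrakk>X \<in> Obj (LMod R U); x \<in> carrier X\<rbrakk> \<Longrightarrow> a \<odot>\<^bsub>X\<^esub> x = b \<odot>\<^bsub>X\<^esub> x"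
  shows "a = b"
proof -
  interpret ring R by fact
  obtain B e where B: "B \<in> U" "bij_betw e (carrier R) B"
    using U unfolding small_in_def by blast
  then have inj: "inj_on e (carrier R)" and im: "e ` carrier R = B"
    by (auto simp: bij_betw_def)
  note simps = transported_module_simps[OF inj]
  have "transported_module R e \<in> Obj (LMod R U)"
    using left_module_transported_module[OF R inj] B im by (simp add: Obj_LMod simps)
  from eq[OF this, of "e \<one>\<^bsub>R\<^esub>"] show ?thesis
    using assms(3,4) inj by (simp add: simps inj_on_def)
qed

section \<open>The center as a ring\<close>

lemma subring_center:
  assumes "ring R"
  shows "subring (carrier (center_ring R)) R"
proof -
  interpret ring R by fact
  show ?thesis
  proof (rule subringI)
    fix a b assume "a \<in> carrier (center_ring R)" "b \<in> carrier (center_ring R)"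
    then have a: "a \<in> carrier R" "\<And>r. r \<in> carrier R \<Longrightarrow> a \<otimes>\<^bsub>R\<^esub> r = r \<otimes>\<^bsub>R\<^esub> a"
      and b: "b \<in> carrier R" "\<And>r. r \<in> carrier R \<Longrightarrow> b \<otimes>\<^bsub>R\<^esub> r = r \<otimes>\<^bsub>R\<^esub> b"
      by (auto simp: center_ring_def)
    have "a \<otimes>\<^bsub>R\<^esub> b \<otimes>\<^bsub>R\<^esub> r = r \<otimes>\<^bsub>R\<^esub> (a \<otimes>\<^bsub>R\<^esub> b)" if r: "r \<in> carrier R" for r
      using a b r by (metis m_assoc)
    then show "a \<otimes>\<^bsub>R\<^esub> b \<in> carrier (center_ring R)"
      using a(1) b(1) by (simp add: center_ring_def)
    show "a \<oplus>\<^bsub>R\<^esub> b \<in> carrier (center_ring R)"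
      using a b by (simp add: center_ring_def l_distr r_distr)
  qed (auto simp: center_ring_def l_minus r_minus)
qed

lemma ring_center_ring:
  assumes "ring R"
  shows "ring (center_ring R)"
  using ring.subring_is_ring[OF assms subring_center[OF assms]] by (simp add: center_ring_def)

section \<open>The embedding of the endomorphism ring of the unit into the center\<close>

theorem theorem4p5:
  fixes R :: "('r, 'x) ring_scheme"
    and U :: "'m set set"
    and T :: "(('r, 'm) module, ('r, 'm) mod_arrow) closed_symmetric_monoidal_structure"
    and K :: "('r, 'm) module"
  assumes "ring R"
    and "small_in (carrier R) U"
    and "closed_symmetric_monoidal_category (LMod R U) T"
    and "additive_tensor R U T"
    and "K = Unit T"
  shows "\<exists>S. subring S (center_ring R) \<and> End_ring R K \<simeq> (center_ring R)\<lparr>carrier := S\<rparr>"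
proof -
  let ?C = "LMod R U"
  let ?Z = "center_ring R"
  let ?E = "End_ring R K"
  interpret closed_symmetric_monoidal_category ?C T by fact
  interpret R: ring R by fact
  have K: "K \<in> Obj ?C"
    using unit_obj assms(5) by simp
  have E_hom: "Arrow K K f \<in> Hom ?C (Unit T) (Unit T)" if "f \<in> carrier ?E" for f
    using that assms(5) by (auto simp: Hom_LMod End_ring_def)
  let ?act = "\<lambda>f. unit_act (Arrow K K f)"
  have ex: "\<exists>z \<in> carrier ?Z. \<forall>X \<in> Obj ?C. \<forall>x \<in> carrier X. Fn (?act f X) x = z \<odot>\<^bsub>X\<^esub> x"
    if "f \<in> carrier ?E" for f
    by (rule natural_endomorphism_central[OF assms(1,2)])
      (simp_all add: unit_act_hom unit_act_natural E_hom that)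
  \<comment> \<open>Choosing a scalar for each \<open>f\<close> is harmless, since by
    \<open>smult_eq_cancel\<close> the action determines it.\<close>
  have "\<exists>h. \<forall>f \<in> carrier ?E. h f \<in> carrier ?Z \<and>
      (\<forall>X \<in> Obj ?C. \<forall>x \<in> carrier X. Fn (?act f X) x = h f \<odot>\<^bsub>X\<^esub> x)"
    by (rule bchoice) (use ex in blast)
  then obtain h where hZ: "\<And>f. f \<in> carrier ?E \<Longrightarrow> h f \<in> carrier ?Z"
    and h: "\<And>f X x. \<lbrakk>f \<in> carrier ?E; X \<in> Obj ?C; x \<in> carrier X\<rbrakk>
      \<Longrightarrow> Fn (?act f X) x = h f \<odot>\<^bsub>X\<^esub> x"
    by blast
  have hR: "h f \<in> carrier R" if "f \<in> carrier ?E" for f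
    using hZ[OF that] by (simp add: center_ring_def)
  interpret E: ring ?E
    using ring_End_ring K by (auto simp: Obj_LMod)
  interpret Z: ring ?Z
    by (rule ring_center_ring) fact
  \<comment> \<open>Each law is verified in \<open>R\<close> by comparing both sides as actions on
    an arbitrary module; the center inherits the operations of \<open>R\<close>.\<close>
  have "h \<in> ring_hom ?E ?Z"
  proof (rule ring_hom_memI)
    fix f g assume f: "f \<in> carrier ?E" and g: "g \<in> carrier ?E"
    note fg = E_hom[OF f] E_hom[OF g]
    have "h (f \<otimes>\<^bsub>?E\<^esub> g) = h f \<otimes>\<^bsub>R\<^esub> h g"
    proof (rule smult_eq_cancel[OF assms(1,2)])
      fix X x assume X: "X \<in> Obj ?C" and x: "x \<in> carrier X"
      interpret left_module R X using X by (simp add: Obj_LMod)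
      have "Arrow K K (f \<otimes>\<^bsub>?E\<^esub> g) = Comp ?C (Arrow K K f) (Arrow K K g)"
        by (simp add: End_ring_def LMod_def)
      then have "h (f \<otimes>\<^bsub>?E\<^esub> g) \<odot>\<^bsub>X\<^esub> x = Fn (Comp ?C (?act f X) (?act g X)) x"
        using h[OF E.m_closed[OF f g] X x] unit_act_comp[OF X fg] by simp
      also have "\<dots> = h f \<odot>\<^bsub>X\<^esub> (h g \<odot>\<^bsub>X\<^esub> x)"
        using f g X x by (simp add: Fn_Comp_LMod[OF unit_act_hom[OF X fg(2)]] h smult_closed hR)
      finally show "h (f \<otimes>\<^bsub>?E\<^esub> g) \<odot>\<^bsub>X\<^esub> x = (h f \<otimes>\<^bsub>R\<^esub> h g) \<odot>\<^bsub>X\<^esub> x"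
        using f g x by (simp add: smult_assoc1 hR)
    qed (simp_all add: hR f g)
    then show "h (f \<otimes>\<^bsub>?E\<^esub> g) = h f \<otimes>\<^bsub>?Z\<^esub> h g"
      by (simp add: center_ring_def)
    have "h (f \<oplus>\<^bsub>?E\<^esub> g) = h f \<oplus>\<^bsub>R\<^esub> h g"
    proof (rule smult_eq_cancel[OF assms(1,2)])
      fix X x assume X: "X \<in> Obj ?C" and x: "x \<in> carrier X"
      interpret left_module R X using X by (simp add: Obj_LMod)
      have fgE: "f \<oplus>\<^bsub>?E\<^esub> g \<in> carrier ?E"
        using f g by simp
      note t = unit_tensor_hom[OF X fg(1)] unit_tensor_hom[OF X fg(2)]
      let ?KX = "TObj T (Unit T) X"
      let ?tensor = "\<lambda>f. TArr T (Arrow K K f) (Ident ?C X)"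
      \<comment> \<open>The action is unfolded into its three factors because additivity concerns
        the middle one, the tensor product with \<open>X\<close>.\<close>
      have act: "Fn (?act k X) x = Fn (LUnit T X) (Fn (?tensor k) (Fn (lunit_inv X) x))"
        if "k \<in> carrier ?E" for k
        unfolding unit_act_def
        using x by (simp add: Fn_Comp_LMod[OF lunit_inv_hom[OF X]]
            Fn_Comp_LMod[OF unit_tensor_hom[OF X E_hom[OF that]]] Fn_closed[OF lunit_inv_hom[OF X]])
      have "Arrow K K (f \<oplus>\<^bsub>?E\<^esub> g) = arrow_add (Arrow K K f) (Arrow K K g)"
        by (simp add: End_ring_def arrow_add_def)
      \<comment> \<open>Here additivity of the tensor product enters. The outer unitor is linear, so
        the sum survives to the end of the composite.\<close>
      then have tensor_add: "?tensor (f \<oplus>\<^bsub>?E\<^esub> g) = arrow_add (?tensor f) (?tensor g)"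
        using assms(4) fg X unit_obj unfolding additive_tensor_def by simp
      have y: "Fn (lunit_inv X) x \<in> carrier ?KX"
        using Fn_closed[OF lunit_inv_hom[OF X] x] .
      have "Fn (?act (f \<oplus>\<^bsub>?E\<^esub> g) X) x = Fn (?act f X) x \<oplus>\<^bsub>X\<^esub> Fn (?act g X) x"
        using y by (simp only: act f g fgE tensor_add Fn_arrow_add[OF t(1)]
            Fn_add[OF lunit_hom[OF X]] Fn_closed[OF t(1)] Fn_closed[OF t(2)])
      then show "h (f \<oplus>\<^bsub>?E\<^esub> g) \<odot>\<^bsub>X\<^esub> x = (h f \<oplus>\<^bsub>R\<^esub> h g) \<odot>\<^bsub>X\<^esub> x"
        using f g fgE X x by (simp add: h smult_l_distr hR)
    qed (simp_all add: hR f g)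
    then show "h (f \<oplus>\<^bsub>?E\<^esub> g) = h f \<oplus>\<^bsub>?Z\<^esub> h g"
      by (simp add: center_ring_def)
  next
    have "h \<one>\<^bsub>?E\<^esub> = \<one>\<^bsub>R\<^esub>"
    proof (rule smult_eq_cancel[OF assms(1,2)])
      fix X x assume X: "X \<in> Obj ?C" and x: "x \<in> carrier X"
      interpret left_module R X using X by (simp add: Obj_LMod)
      have "Arrow K K \<one>\<^bsub>?E\<^esub> = Ident ?C (Unit T)"
        using assms(5) by (simp add: End_ring_def LMod_def)
      then show "h \<one>\<^bsub>?E\<^esub> \<odot>\<^bsub>X\<^esub> x = \<one>\<^bsub>R\<^esub> \<odot>\<^bsub>X\<^esub> x"
        using h[OF E.one_closed X x] unit_act_ident[OF X] x by (simp add: Fn_Ident_LMod smult_one)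
    qed (simp_all add: hR)
    then show "h \<one>\<^bsub>?E\<^esub> = \<one>\<^bsub>?Z\<^esub>"
      by (simp add: center_ring_def)
  qed (fact hZ)
  then interpret h: ring_hom_ring ?E ?Z h
    by unfold_locales
  have "inj_on h (carrier ?E)"
  proof (rule inj_onI)
    fix f g assume f: "f \<in> carrier ?E" and g: "g \<in> carrier ?E" and eq: "h f = h g"
    \<comment> \<open>Equal scalars act equally on the unit object, and this action already
      determines the endomorphism.\<close>
    have "?act f (Unit T) = ?act g (Unit T)"
      by (rule Hom_LMod_eqI[OF unit_act_hom unit_act_hom])
        (use f g eq in \<open>simp_all add: unit_obj E_hom h\<close>)
    then show "f = g"
      using unit_act_inject E_hom f g by blast
  qed
  \<comment> \<open>Restricting the codomain to the image makes the injective homomorphism bijective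
    and leaves the operations unchanged.\<close>
  then have "h \<in> ring_iso ?E (?Z\<lparr>carrier := h ` carrier ?E\<rparr>)"
    using h.homh by (auto simp: ring_iso_def ring_hom_def bij_betw_def)
  moreover have "subring (h ` carrier ?E) ?Z"
    by (rule h.img_is_subring[OF E.carrier_is_subring])
  ultimately show ?thesis
    unfolding is_ring_iso_def by blast
qed

end
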